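(* For every admissible $n$ (that is, every integer $n\ge 6$ with $n\equiv 0$ or $1 \pmod 3$), there exists an equitably $2$-chromatic $3$-star system of order $n$.
   Context: An $e$-star is the complete bipartite graph $K_{1,e}$. An $e$-star system of order $n$ is a pair $(V,\mathcal B)$ where $|V|=n$ and $\mathcal B$ is a set of $e$-stars (subgraphs of the complete graph $K_n$ on $V$) whose edge sets partition the edge set of $K_n$. An $e$-star system is $k$-colourable if $V$ can be partitioned into $k$ sets (colour classes) such that no star in $\mathcal B$ has all its $e+1$ vertices in the same class; it is $k$-chromatic if it is $k$-colourable but not $(k-1)$-colourable. A colouring is equitable if the sizes of the colour classes differ by at most one. An $e$-star system is equitably $k$-chromatic if it is $k$-chromatic and admits an equitable $k$-colouring. A $3$-star system of order $n$ exists if and only if $n\equiv 0,1 \pmod 3$ and $n\ge 6$; such $n$ are called admissible. *)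

theory Defs
  imports "HOL-Library.Disjoint_Sets" "HOL-Number_Theory.Cong"
begin

text \<open>A simple graph is a pair of a vertex set and a set of two-element edges.\<close>

type_synonym 'a graph = "'a set \<times> 'a set set"

definition complete_graph :: "'a set \<Rightarrow> 'a graph" where
  "complete_graph V = (V, {{u, v} | u v. u \<in> V \<and> v \<in> V \<and> u \<noteq> v})"

definition subgraph_of :: "'a graph \<Rightarrow> 'a graph \<Rightarrow> bool" where
  "subgraph_of H G \<longleftrightarrow> fst H \<subseteq> fst G \<and> snd H \<subseteq> snd G"

definition is_star :: "nat \<Rightarrow> 'a graph \<Rightarrow> bool" where
  "is_star e S \<longleftrightarrow> (\<exists>c L. finite L \<and> card L = e \<and> c \<notin> L \<and>
     S = (insert c L, {{c, x} | x. x \<in> L}))"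

definition star_system :: "nat \<Rightarrow> nat \<Rightarrow> 'a set \<Rightarrow> 'a graph set \<Rightarrow> bool" where
  "star_system e n V B \<longleftrightarrow>
     finite V \<and> card V = n \<and>
     (\<forall>S\<in>B. is_star e S \<and> subgraph_of S (complete_graph V)) \<and>
     disjoint_family_on snd B \<and>
     (\<Union>S\<in>B. snd S) = snd (complete_graph V)"

text \<open>A colouring is identified with its set \<open>P\<close> of (nonempty) colour classes.\<close>

definition colouring :: "'a set \<Rightarrow> 'a graph set \<Rightarrow> nat \<Rightarrow> 'a set set \<Rightarrow> bool" where
  "colouring V B k P \<longleftrightarrow>
     partition_on V P \<and> card P = k \<and> (\<forall>S\<in>B. \<forall>C\<in>P. \<not> fst S \<subseteq> C)"

definition colourable :: "'a set \<Rightarrow> 'a graph set \<Rightarrow> nat \<Rightarrow> bool" where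
  "colourable V B k \<longleftrightarrow> (\<exists>P. colouring V B k P)"

text \<open>Only meaningful for \<open>k \<ge> 1\<close>, since \<open>k - 1\<close> is truncated subtraction.\<close>

definition chromatic :: "'a set \<Rightarrow> 'a graph set \<Rightarrow> nat \<Rightarrow> bool" where
  "chromatic V B k \<longleftrightarrow> colourable V B k \<and> \<not> colourable V B (k - 1)"

definition equitable :: "'a set set \<Rightarrow> bool" where
  "equitable P \<longleftrightarrow> (\<forall>C\<in>P. \<forall>D\<in>P. card C \<le> card D + 1)"

definition equitably_chromatic :: "'a set \<Rightarrow> 'a graph set \<Rightarrow> nat \<Rightarrow> bool" where
  "equitably_chromatic V B k \<longleftrightarrow>
     chromatic V B k \<and> (\<exists>P. colouring V B k P \<and> equitable P)"

end

theory Submission imports Defs begin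

text \<open>
  Colour the vertices \<open>0, \<dots>, n - 1\<close> by parity; this is equitable for every \<open>n\<close>.
  On \<open>{0..<6}\<close> take the stars with centre \<open>i < 5\<close> and leaves \<open>i + 1, i + 2\<close> (modulo 5) and \<open>5\<close>.
  Adding a vertex \<open>6\<close> needs only the stars with centre \<open>6\<close> and leaves \<open>0, 1, 2\<close> and \<open>3, 4, 5\<close>.
  To pass from \<open>n \<ge> 2\<close> to \<open>n + 3\<close>, each \<open>v\<close> with \<open>2 \<le> v < n\<close> becomes the centre of a star with
  leaves \<open>n, n + 1, n + 2\<close>, and the new triangle, oriented cyclically, is absorbed by the three stars
  joining a new vertex to its successor and to \<open>0, 1\<close>.  All these stars contain
  two consecutive integers, hence both colours.
\<close>

definition spokes :: "'a \<Rightarrow> 'a set \<Rightarrow> 'a set set" where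
  "spokes c L = {{c, x} | x. x \<in> L}"

definition parity_mixed :: "nat set \<Rightarrow> bool" where
  "parity_mixed A \<longleftrightarrow> (\<exists>x\<in>A. even x) \<and> (\<exists>x\<in>A. odd x)"

text \<open>Only the edge set is a parameter, not a vertex set, so intermediate stages of a
  construction, which are not complete graphs, are covered too. The vertex condition of
  \<open>star_system\<close> is recovered from the edges in the final theorem.\<close>

definition mixed_star_decomposable :: "nat set set \<Rightarrow> bool" where
  "mixed_star_decomposable E \<longleftrightarrow> (\<exists>B.
     (\<forall>S\<in>B. is_star 3 S \<and> parity_mixed (fst S)) \<and>
     disjoint_family_on snd B \<and> (\<Union>S\<in>B. snd S) = E)"

lemma spokes_insert: "spokes c (insert x L) = insert {c, x} (spokes c L)"
  by (auto simp: spokes_def)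

lemma spokes_empty: "spokes c {} = {}"
  by (auto simp: spokes_def)

lemma complete_graph_insert:
  "a \<notin> V \<Longrightarrow> snd (complete_graph (insert a V)) = snd (complete_graph V) \<union> spokes a V"
  by (auto simp: complete_graph_def spokes_def doubleton_eq_iff)

lemma parity_mixed_consecutive: "x \<in> A \<Longrightarrow> Suc x \<in> A \<Longrightarrow> parity_mixed A"
  unfolding parity_mixed_def by (cases "even x") (meson even_Suc)+

lemma mixed_star_decomposable_empty: "mixed_star_decomposable {}"
  unfolding mixed_star_decomposable_def
  by (intro exI[of _ "{}"]) (auto simp: disjoint_family_on_def)

text \<open>Turns each construction into a union of \<open>spokes\<close> added one by one, leaving
  only size, parity and edge-disjointness conditions, which automation settles.\<close>

lemma mixed_star_decomposable_add_star:
  assumes E: "mixed_star_decomposable E" and L: "card L = 3" "c \<notin> L"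
    and mixed: "parity_mixed (insert c L)" and disj: "E \<inter> spokes c L = {}"
  shows "mixed_star_decomposable (E \<union> spokes c L)"
proof -
  obtain B where B: "\<forall>S\<in>B. is_star 3 S \<and> parity_mixed (fst S)"
    "disjoint_family_on snd B" "(\<Union>S\<in>B. snd S) = E"
    using E unfolding mixed_star_decomposable_def by blast
  let ?S = "(insert c L, spokes c L)"
  have "finite L" using L by (intro card_ge_0_finite) simp
  then have "is_star 3 ?S"
    using L unfolding is_star_def spokes_def by blast
  moreover have "disjoint_family_on snd (insert ?S B)"
    unfolding disjoint_family_on_def
  proof (intro ballI impI)
    fix S T assume "S \<in> insert ?S B" "T \<in> insert ?S B" "S \<noteq> T"
    then consider "S \<in> B" "T \<in> B" | "S = ?S" "T \<in> B" | "S \<in> B" "T = ?S" by blast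
    then show "snd S \<inter> snd T = {}"
    proof cases
      case 1
      then show ?thesis using B(2) \<open>S \<noteq> T\<close> unfolding disjoint_family_on_def by blast
    next
      case 2
      then have "snd T \<subseteq> E" using B(3) by blast
      then show ?thesis using 2 disj by auto
    next
      case 3
      then have "snd S \<subseteq> E" using B(3) by blast
      then show ?thesis using 3 disj by auto
    qed
  qed
  moreover have "(\<Union>S\<in>insert ?S B. snd S) = E \<union> spokes c L"
    using B by auto
  ultimately show ?thesis
    using B mixed unfolding mixed_star_decomposable_def
    by (intro exI[of _ "insert ?S B"]) auto
qed

lemma complete_6_decomposable: "mixed_star_decomposable (snd (complete_graph {..<6}))"
proof -
  \<comment> \<open>The leading \<open>{}\<close> is where the repeated introduction rule ends, once
    all five stars are peeled off.\<close>
  let ?E = "{} \<union> spokes 0 {1, 2, 5} \<union> spokes 1 {2, 3, 5} \<union> spokes 2 {3, 4, 5}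
    \<union> spokes 3 {4, 0, 5} \<union> spokes 4 {0, 1, 5} :: nat set set"
  have "mixed_star_decomposable ?E"
    by (intro mixed_star_decomposable_add_star mixed_star_decomposable_empty)
      (simp_all add: parity_mixed_def spokes_insert spokes_empty doubleton_eq_iff)
  moreover have "{..<6} = {0, 1, 2, 3, 4, 5 :: nat}"
    by auto
  then have "snd (complete_graph {..<6}) = ?E"
    by (simp add: complete_graph_insert spokes_insert spokes_empty)
      (auto simp: complete_graph_def doubleton_eq_iff)
  ultimately show ?thesis by simp
qed

lemma complete_7_decomposable: "mixed_star_decomposable (snd (complete_graph {..<7}))"
proof -
  have "mixed_star_decomposable
      (snd (complete_graph {..<6}) \<union> spokes 6 {0, 1, 2} \<union> spokes 6 {3, 4, 5})"
    by (intro mixed_star_decomposable_add_star complete_6_decomposable)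
      (auto simp: parity_mixed_def spokes_insert spokes_empty doubleton_eq_iff complete_graph_def)
  moreover have "{..<7} = insert 6 {..<6 :: nat}" and "{..<6} = {0, 1, 2, 3, 4, 5 :: nat}"
    by auto
  then have "snd (complete_graph {..<7}) =
      snd (complete_graph {..<6}) \<union> spokes 6 {0, 1, 2} \<union> spokes 6 {3, 4, 5 :: nat}"
    using complete_graph_insert[of 6 "{..<6 :: nat}"] by (auto simp: spokes_def)
  ultimately show ?thesis by simp
qed

lemma complete_add_3_decomposable:
  assumes K: "mixed_star_decomposable (snd (complete_graph {..<n}))" and n: "2 \<le> n"
  shows "mixed_star_decomposable (snd (complete_graph {..<n + 3}))"
proof -
  let ?N = "{n, n + 1, n + 2}"
  \<comment> \<open>Centres start at 2: the six edges from \<open>0\<close> and \<open>1\<close> to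
    \<open>?N\<close> are reserved for the last three stars, which take two each besides one edge of
    the triangle on \<open>?N\<close>.\<close>
  let ?F = "\<lambda>k. snd (complete_graph {..<n}) \<union> (\<Union>v\<in>{2..<k}. spokes v ?N)"
  have F: "mixed_star_decomposable (?F k)" if "2 \<le> k" "k \<le> n" for k
    using that
  proof (induction k rule: dec_induct)
    case base
    then show ?case using K by simp
  next
    case (step k)
    \<comment> \<open>Since \<open>k < n\<close>, every new edge has \<open>k\<close> as its only
      end below \<open>n\<close>, so it lies neither in the old complete graph nor among the spokes
      of an earlier centre. The parities are mixed because \<open>n\<close> and \<open>n + 1\<close>
      are leaves.\<close>
    have "mixed_star_decomposable (?F k \<union> spokes k ?N)"
      using step
      by (intro mixed_star_decomposable_add_star)
        (auto simp: spokes_insert spokes_empty doubleton_eq_iff complete_graph_def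
          intro: parity_mixed_consecutive[of n])
    moreover have "{2..<Suc k} = insert k {2..<k}" using step by auto
    ultimately show ?case by (simp add: Un_ac)
  qed
  have "mixed_star_decomposable (?F n \<union> spokes n {n + 1, 0, 1} \<union> spokes (n + 1) {n + 2, 0, 1}
      \<union> spokes (n + 2) {n, 0, 1})" (is "mixed_star_decomposable ?G")
    using n
    by (intro mixed_star_decomposable_add_star F)
      (auto simp: spokes_insert spokes_empty doubleton_eq_iff complete_graph_def
        intro: parity_mixed_consecutive[of 0])
  moreover have "snd (complete_graph {..<n + 3}) = ?G"
  proof -
    have "{..<n + 3} = insert (n + 2) (insert (n + 1) (insert n {..<n}))" by auto
    then have "snd (complete_graph {..<n + 3}) = snd (complete_graph {..<n}) \<union> spokes n {..<n}
        \<union> spokes (n + 1) (insert n {..<n}) \<union> spokes (n + 2) (insert (n + 1) (insert n {..<n}))"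
      by (simp add: complete_graph_insert)
    moreover have "spokes c {..<n} = spokes c {0, 1} \<union> spokes c {2..<n}" for c
    proof -
      have "{..<n} = {0, 1} \<union> {2..<n}" using n by auto
      then show ?thesis by (auto simp: spokes_def)
    qed
    \<comment> \<open>The same bipartite edges seen from the other side: the stars have old centres,
      while \<open>complete_graph_insert\<close> produces spokes at the new vertices.\<close>
    moreover have "(\<Union>v\<in>{2..<n}. spokes v ?N) =
        spokes n {2..<n} \<union> spokes (n + 1) {2..<n} \<union> spokes (n + 2) {2..<n}"
      unfolding spokes_def by blast
    ultimately show ?thesis
      by (simp add: spokes_insert spokes_empty insert_commute Un_ac)
  qed
  ultimately show ?thesis by simp
qed

lemma complete_decomposable:
  assumes "6 \<le> n" and "n mod 3 = 0 \<or> n mod 3 = 1"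
  shows "mixed_star_decomposable (snd (complete_graph {..<n}))"
  using assms
proof (induction n rule: less_induct)
  case (less n)
  \<comment> \<open>The residue excludes 8, and from 9 on \<open>n - 3\<close> is again at least
    6.\<close>
  consider "n = 6" | "n = 7" | "9 \<le> n"
    using less.prems by (cases "n = 8") (simp, linarith)
  then show ?case
  proof cases
    case 3
    then have "mixed_star_decomposable (snd (complete_graph {..<n - 3}))"
      using less.prems by (intro less.IH) (auto simp: le_mod_geq)
    from complete_add_3_decomposable[OF this] 3 show ?thesis by simp
  qed (simp_all add: complete_6_decomposable complete_7_decomposable)
qed

lemma card_even_odd_lessThan:
  "card {x \<in> {..<n :: nat}. even x} = (n + 1) div 2 \<and> card {x \<in> {..<n}. odd x} = n div 2"
proof (induction n)
  case (Suc n)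
  have "{x \<in> {..<Suc n}. P x} =
      (if P n then insert n {x \<in> {..<n}. P x} else {x \<in> {..<n}. P x})" for P
    by (auto simp: less_Suc_eq)
  then show ?case using Suc by auto
qed simp

theorem theorem2p1:
  fixes n :: nat
  assumes "n \<ge> 6" and "[n = 0] (mod 3) \<or> [n = 1] (mod 3)"
  shows "\<exists>(V :: nat set) B. star_system 3 n V B \<and> equitably_chromatic V B 2"
proof -
  let ?V = "{..<n}"
  let ?ev = "{x \<in> ?V. even x}" and ?od = "{x \<in> ?V. odd x}"
  have "mixed_star_decomposable (snd (complete_graph ?V))"
    using assms by (intro complete_decomposable) (auto simp: cong_def)
  then obtain B where star: "\<And>S. S \<in> B \<Longrightarrow> is_star 3 S"
    and mixed: "\<And>S. S \<in> B \<Longrightarrow> parity_mixed (fst S)"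
    and disj: "disjoint_family_on snd B" and un: "(\<Union>S\<in>B. snd S) = snd (complete_graph ?V)"
    unfolding mixed_star_decomposable_def by blast
  \<comment> \<open>A star with at least one leaf has no isolated vertex, so its vertices are the
    union of its edges, and these lie in the complete graph.\<close>
  have sub: "fst S \<subseteq> ?V" if S_in: "S \<in> B" for S
  proof -
    obtain c L where L: "card L = 3" and S: "S = (insert c L, {{c, x} | x. x \<in> L})"
      using star[OF S_in] unfolding is_star_def by blast
    have "L \<noteq> {}" using L by auto
    then have "fst S = \<Union>(snd S)" unfolding S by auto
    also have "\<dots> \<subseteq> \<Union>(snd (complete_graph ?V))" using un S_in by blast
    also have "\<dots> \<subseteq> ?V" by (auto simp: complete_graph_def)
    finally show ?thesis .
  qed
  have system: "star_system 3 n ?V B"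
    unfolding star_system_def subgraph_of_def
  proof (intro conjI ballI)
    fix S assume "S \<in> B"
    then show "is_star 3 S" "snd S \<subseteq> snd (complete_graph ?V)" using star un by blast+
    show "fst S \<subseteq> fst (complete_graph ?V)"
      using sub[OF \<open>S \<in> B\<close>] by (simp add: complete_graph_def)
  qed (use disj un in auto)
  have "0 \<in> ?ev" and "1 \<in> ?od" using assms(1) by auto
  then have ne: "?ev \<noteq> {}" "?od \<noteq> {}" by blast+
  have dj: "?ev \<inter> ?od = {}" and cover: "?ev \<union> ?od = ?V" by auto
  have part: "partition_on ?V {?ev, ?od}"
    unfolding partition_on_def disjoint_def using ne dj cover by auto
  have "?ev \<noteq> ?od" using ne dj by blast
  then have two: "card {?ev, ?od} = 2" by (simp only: card_2_iff) blast
  have "\<not> fst S \<subseteq> ?ev \<and> \<not> fst S \<subseteq> ?od" if "S \<in> B" for S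
    using mixed[OF that] unfolding parity_mixed_def by blast
  then have col: "colouring ?V B 2 {?ev, ?od}"
    unfolding colouring_def using part two by blast
  have "equitable {?ev, ?od}"
    unfolding equitable_def using card_even_odd_lessThan[of n] by auto
  \<comment> \<open>A single class is all of \<open>?V\<close> and contains every star, so it would
    force \<open>B\<close> to be empty, leaving the edge \<open>{0, 1}\<close> uncovered.\<close>
  moreover have "\<not> colourable ?V B 1"
  proof
    assume "colourable ?V B 1"
    then obtain C where C: "partition_on ?V {C}" and no: "\<forall>S\<in>B. \<not> fst S \<subseteq> C"
      unfolding colourable_def colouring_def by (auto simp: card_1_singleton_iff)
    have "C = ?V" using C by (simp add: partition_on_def)
    then have "B = {}" using no sub by blast
    moreover have "{0, 1} \<in> snd (complete_graph ?V)"
      using assms(1) by (force simp: complete_graph_def)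
    ultimately show False using un by simp
  qed
  ultimately have "equitably_chromatic ?V B 2"
    unfolding equitably_chromatic_def chromatic_def colourable_def using col by auto
  with system show ?thesis by blast
qed

end
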